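(* Let $c>0$, $c\neq 1$, $\gamma\ge 0$ and $\gamma+\beta>0$ be real, and put $\tilde c=\frac{c-1}{c}$. Then for every integer $n\ge 0$, as polynomials in $x$, $$\mathscr{M}_n(x;\beta,c,\gamma)=\frac{(\gamma+1)_n(\gamma+\beta)_n}{n!}\sum_{k=0}^{n}\tilde c^{\,k}\frac{(-n)_k(\gamma-x)_k}{(\gamma+1)_k(\gamma+\beta)_k}\;{}_4F_3\left(\begin{array}{c}k-n,\ \gamma-x+k,\ \gamma+\beta-1,\ \gamma\\ \gamma-x,\ \gamma+\beta+k,\ \gamma+1+k\end{array}\Big|\,1\right).$$
   Context: The associated Meixner polynomials $\mathscr{M}_n(x;\beta,c,\gamma)$ are defined by $\mathscr{M}_{-1}=0$, $\mathscr{M}_0=1$ and, for $n\ge 0$, $$c\,\mathscr{M}_{n+1}(x;\beta,c,\gamma)=[(c-1)x+(c+1)(n+\gamma)+\beta c]\,\mathscr{M}_n(x;\beta,c,\gamma)-(n+\gamma)(n+\gamma+\beta-1)\,\mathscr{M}_{n-1}(x;\beta,c,\gamma).$$ Pochhammer symbol: $(a)_0=1$, $(a)_k=a(a+1)\cdots(a+k-1)$ for $k\ge1$. The series ${}_4F_3\left(\begin{array}{c}k-n,a_2,a_3,a_4\\ b_1,b_2,b_3\end{array}\Big|1\right)=\sum_{j=0}^{n-k}\frac{(k-n)_j(a_2)_j(a_3)_j(a_4)_j}{(b_1)_j(b_2)_j(b_3)_j\,j!}$ is a terminating hypergeometric sum. Convention: the factor $(\gamma-x)_k(\gamma-x+k)_j/(\gamma-x)_j$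 in each term is a polynomial in $x$ (equal to $(\gamma-x+j)_k$), so at the finitely many $x$ where $(\gamma-x)_j$ vanishes the right-hand side is understood by continuity in $x$. *)

theory Defs
  imports Complex_Main "HOL-Computational_Algebra.Polynomial"
begin

text \<open>The inner \<open>case\<close> implements the convention that the polynomial of index \<open>-1\<close> is zero.\<close>

fun assoc_meixner :: "real \<Rightarrow> real \<Rightarrow> real \<Rightarrow> nat \<Rightarrow> real poly" where
  "assoc_meixner \<beta> c \<gamma> 0 = 1"
| "assoc_meixner \<beta> c \<gamma> (Suc n) =
     smult (1 / c)
       ([:(c + 1) * (real n + \<gamma>) + \<beta> * c, c - 1:] * assoc_meixner \<beta> c \<gamma> n
        - smult ((real n + \<gamma>) * (real n + \<gamma> + \<beta> - 1))
            (case n of 0 \<Rightarrow> 0 | Suc m \<Rightarrow> assoc_meixner \<beta> c \<gamma> m))"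

text \<open>The terminating \<open>4F3\<close> series at argument \<open>1\<close> with first upper parameter \<open>-m\<close>.
  Since division by zero yields zero, it is meaningful only if no
  lower parameter \<open>b\<close> has \<open>pochhammer b j = 0\<close> for some \<open>j \<le> m\<close>.\<close>

definition hyp4F3_one :: "nat \<Rightarrow> real \<Rightarrow> real \<Rightarrow> real \<Rightarrow> real \<Rightarrow> real \<Rightarrow> real \<Rightarrow> real" where
  "hyp4F3_one m a2 a3 a4 b1 b2 b3 =
     (\<Sum>j=0..m. pochhammer (- real m) j * pochhammer a2 j * pochhammer a3 j * pochhammer a4 j
        / (pochhammer b1 j * pochhammer b2 j * pochhammer b3 j * fact j))"

end

theory Submission
  imports Defs
begin

text \<open>
  Write \<open>t = (c - 1) / c\<close>. Collecting the double sum by \<open>m = k + j\<close> gives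
  \<open>\<Sum>m\<le>n. A n m * S m\<close>, where \<open>A n m\<close> does not depend on \<open>x\<close> and the polynomials \<open>S m\<close> in \<open>x\<close>
  satisfy the first-order recurrence \<open>S (m + 1) = t (\<gamma> - x + m) S m + e (m + 1)\<close>.
  This rewrites \<open>t x S m\<close> in terms of \<open>S m\<close> and \<open>S (m + 1)\<close>; comparing the coefficients of \<open>S m\<close>
  then turns the three-term recurrence into contiguity relations for \<open>A\<close>. The terms left over,
  coming from the inhomogeneity \<open>e\<close> and from \<open>m = 0\<close>, cancel because an alternating sum of
  binomial coefficients vanishes.
\<close>

section \<open>Expansion coefficients and basis polynomials\<close>

text \<open>This is \<open>A n m\<close>, with the outer prefactor absorbed. It depends on k and j
  only through m = k + j because (a)_k (a + k)_j = (a)_(k + j).\<close>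

definition meixner_coeff :: "real \<Rightarrow> real \<Rightarrow> nat \<Rightarrow> nat \<Rightarrow> real" where
  "meixner_coeff \<beta> \<gamma> n m =
     pochhammer (\<gamma> + 1) n * pochhammer (\<gamma> + \<beta>) n * pochhammer (- real n) m
       / (fact n * pochhammer (\<gamma> + 1) m * pochhammer (\<gamma> + \<beta>) m)"

definition meixner_inhom :: "real \<Rightarrow> real \<Rightarrow> nat \<Rightarrow> real" where
  "meixner_inhom \<beta> \<gamma> j = pochhammer (\<gamma> + \<beta> - 1) j * pochhammer \<gamma> j / fact j"

text \<open>This is \<open>S m\<close>, with j = m - k. The quotient (\<gamma> - x)_k (\<gamma> - x
  + k)_j / (\<gamma> - x)_j enters in its polynomial form (\<gamma> - x + j)_k, so no x is
  exceptional.\<close>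

definition meixner_basis :: "real \<Rightarrow> real \<Rightarrow> real \<Rightarrow> real \<Rightarrow> nat \<Rightarrow> real" where
  "meixner_basis \<beta> t \<gamma> x m =
     (\<Sum>k\<le>m. t ^ k * pochhammer (\<gamma> - x + real (m - k)) k * meixner_inhom \<beta> \<gamma> (m - k))"

lemma meixner_basis_0 [simp]: "meixner_basis \<beta> t \<gamma> x 0 = 1"
  by (simp add: meixner_basis_def meixner_inhom_def)

text \<open>For every i the last factor of the Pochhammer symbol in \<open>step\<close> is \<gamma>
  - x + m, so it leaves the sum; the summand k = 0 remains as the inhomogeneity.\<close>

lemma meixner_basis_Suc:
  "meixner_basis \<beta> t \<gamma> x (Suc m) =
     t * (\<gamma> - x + real m) * meixner_basis \<beta> t \<gamma> x m + meixner_inhom \<beta> \<gamma> (Suc m)"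
proof -
  have step: "t ^ Suc i * pochhammer (\<gamma> - x + real (m - i)) (Suc i) * meixner_inhom \<beta> \<gamma> (m - i)
      = t * (\<gamma> - x + real m) *
        (t ^ i * pochhammer (\<gamma> - x + real (m - i)) i * meixner_inhom \<beta> \<gamma> (m - i))"
    if "i \<le> m" for i
    using that by (simp add: pochhammer_Suc of_nat_diff)
  have "meixner_basis \<beta> t \<gamma> x (Suc m) = meixner_inhom \<beta> \<gamma> (Suc m) +
      (\<Sum>i\<le>m. t ^ Suc i * pochhammer (\<gamma> - x + real (m - i)) (Suc i) * meixner_inhom \<beta> \<gamma> (m - i))"
    unfolding meixner_basis_def by (subst sum.atMost_Suc_shift) simp
  also have "(\<Sum>i\<le>m. t ^ Suc i * pochhammer (\<gamma> - x + real (m - i)) (Suc i) * meixner_inhom \<beta> \<gamma> (m - i))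
      = t * (\<gamma> - x + real m) * meixner_basis \<beta> t \<gamma> x m"
    unfolding meixner_basis_def sum_distrib_left by (rule sum.cong) (use step in auto)
  finally show ?thesis by simp
qed

section \<open>Contiguity relations for the coefficients\<close>

lemma pochhammer_neg_Suc_left:
  "pochhammer (- real (Suc n)) (Suc m) = - (real n + 1) * pochhammer (- real n) m"
  by (simp add: pochhammer_rec)

text \<open>Up to a common factor this is f(m) - f(n) = (m - n) (m + n + 1 + 2\<gamma> + \<beta>)
  for the quadratic f(y) = (\<gamma> + 1 + y) (\<gamma> + \<beta> + y). The hypotheses keep the
  denominators nonzero.\<close>

lemma meixner_coeff_Suc_Suc:
  assumes "\<gamma> > -1" "\<gamma> + \<beta> > 0"
  shows "meixner_coeff \<beta> \<gamma> (Suc n) (Suc m) =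
    (real n + real (Suc m) + 2 * \<gamma> + \<beta>) * meixner_coeff \<beta> \<gamma> n (Suc m) - meixner_coeff \<beta> \<gamma> n m"
proof -
  define q where "q = pochhammer (- real n) m"
  define a where "a = \<gamma> + 1 + real m"
  define b where "b = \<gamma> + \<beta> + real m"
  define P where "P = pochhammer (\<gamma> + 1) n * pochhammer (\<gamma> + \<beta>) n / fact n"
  define Q where "Q = pochhammer (\<gamma> + 1) m * pochhammer (\<gamma> + \<beta>) m"
  have pos: "Q \<noteq> 0" "a \<noteq> 0" "b \<noteq> 0"
    using assms pochhammer_pos[of "\<gamma> + 1" m] pochhammer_pos[of "\<gamma> + \<beta>" m]
    by (auto simp: Q_def a_def b_def)
  have 1: "meixner_coeff \<beta> \<gamma> n m = P * q / Q"
    by (simp add: meixner_coeff_def P_def q_def Q_def)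
  have 2: "meixner_coeff \<beta> \<gamma> n (Suc m) = P * q * (real m - real n) / (Q * a * b)"
    by (simp add: meixner_coeff_def P_def q_def Q_def a_def b_def pochhammer_Suc mult_ac)
  have "meixner_coeff \<beta> \<gamma> (Suc n) (Suc m) =
      pochhammer (\<gamma> + 1) n * (\<gamma> + 1 + real n) * (pochhammer (\<gamma> + \<beta>) n * (\<gamma> + \<beta> + real n)) *
      (- (real n + 1) * q) / ((real n + 1) * fact n * (pochhammer (\<gamma> + 1) m * a) * (pochhammer (\<gamma> + \<beta>) m * b))"
    unfolding meixner_coeff_def pochhammer_neg_Suc_left
    by (simp add: q_def a_def b_def pochhammer_Suc add_ac)
  also have "\<dots> = - P * q * (\<gamma> + 1 + real n) * (\<gamma> + \<beta> + real n) / (Q * a * b)"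
    using pos by (simp add: P_def Q_def divide_simps del: of_nat_Suc) (auto simp: algebra_simps)
  finally have 3: "meixner_coeff \<beta> \<gamma> (Suc n) (Suc m) =
      - P * q * (\<gamma> + 1 + real n) * (\<gamma> + \<beta> + real n) / (Q * a * b)" .
  have id: "- ((\<gamma> + 1 + real n) * (\<gamma> + \<beta> + real n)) =
     (real n + real (Suc m) + 2 * \<gamma> + \<beta>) * (real m - real n) - a * b"
    by (simp add: a_def b_def algebra_simps)
  have "- P * q * (\<gamma> + 1 + real n) * (\<gamma> + \<beta> + real n) = P * q * (- ((\<gamma> + 1 + real n) * (\<gamma> + \<beta> + real n)))"
    by simp
  then show ?thesis
    unfolding 1 2 3 id using pos by (simp add: divide_simps del: of_nat_Suc) (simp add: algebra_simps)
qed

text \<open>Splitting off the first or the last factor of (-n-1)_(m+1) relates (-n-1)_m to (-n)_m.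
  The relation absorbs the factor that the three-term recurrence puts before the polynomial two
  indices down. In this undivided form it also covers m = n + 1, where both sides vanish.\<close>

lemma meixner_coeff_Suc_left:
  "(real (Suc n) - real m) * meixner_coeff \<beta> \<gamma> (Suc n) m =
     (real (Suc n) + \<gamma>) * (real n + \<gamma> + \<beta>) * meixner_coeff \<beta> \<gamma> n m"
proof -
  have "pochhammer (- real (Suc n)) (Suc m) = pochhammer (- real (Suc n)) m * (real m - real (Suc n))"
    by (simp add: pochhammer_Suc)
  then have "(real (Suc n) - real m) * pochhammer (- real (Suc n)) m
      = (real n + 1) * pochhammer (- real n) m"
    using pochhammer_neg_Suc_left[of n m] by (simp add: algebra_simps)
  then have "(real (Suc n) - real m) * meixner_coeff \<beta> \<gamma> (Suc n) m =
     pochhammer (\<gamma> + 1) (Suc n) * pochhammer (\<gamma> + \<beta>) (Suc n) * ((real n + 1) * pochhammer (- real n) m)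
       / (fact (Suc n) * pochhammer (\<gamma> + 1) m * pochhammer (\<gamma> + \<beta>) m)"
    unfolding meixner_coeff_def by (metis mult.left_commute times_divide_eq_right)
  also have "\<dots> = (real (Suc n) + \<gamma>) * (real n + \<gamma> + \<beta>) * meixner_coeff \<beta> \<gamma> n m"
    by (simp add: meixner_coeff_def pochhammer_Suc divide_simps) (simp add: algebra_simps)
  finally show ?thesis .
qed

lemma meixner_coeff_eq_0: "n < m \<Longrightarrow> meixner_coeff \<beta> \<gamma> n m = 0"
  by (simp add: meixner_coeff_def pochhammer_of_nat_eq_0_iff)

section \<open>Boundary terms\<close>

text \<open>Up to the factor -1 / (n + 1), the summands are the alternating binomial coefficients of
  row n + 1 without the first one; the full row sums to 0.\<close>

lemma sum_pochhammer_neg_div_fact_Suc: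
  "(\<Sum>m\<le>n. pochhammer (- real n) m / fact (Suc m)) = 1 / (real n + 1)"
proof -
  have binom: "pochhammer (- real N) m / fact m = (-1) ^ m * real (N choose m)" for N m
    by (simp add: binomial_gbinomial gbinomial_pochhammer)
  have eq: "pochhammer (- real n) m / fact (Suc m) =
      - ((-1) ^ Suc m * real (Suc n choose Suc m)) / (real n + 1)" for m
    unfolding binom[symmetric] pochhammer_neg_Suc_left by (simp add: divide_simps) (simp add: algebra_simps)
  have "0 = (\<Sum>m\<le>Suc n. (-1) ^ m * real (Suc n choose m))"
    by (rule choose_alternating_sum[symmetric]) simp
  also have "\<dots> = 1 + (\<Sum>m\<le>n. (-1) ^ Suc m * real (Suc n choose Suc m))"
    by (subst sum.atMost_Suc_shift) simp
  finally have "(\<Sum>m\<le>n. (-1) ^ Suc m * real (Suc n choose Suc m)) = -1" by linarith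
  then show ?thesis
    unfolding eq sum_divide_distrib[symmetric] sum_negf by simp
qed

text \<open>The Pochhammer symbols of \<open>meixner_inhom\<close> cancel the denominators of
  \<open>meixner_coeff\<close>, which leaves the preceding sum. The result plays the part of the
  contiguity relation at m = -1.\<close>

lemma sum_meixner_coeff_inhom:
  assumes "\<gamma> > -1" "\<gamma> + \<beta> > 0"
  shows "(\<Sum>m\<le>n. meixner_coeff \<beta> \<gamma> n m * meixner_inhom \<beta> \<gamma> (Suc m)) =
    (real n + 2 * \<gamma> + \<beta>) * (- meixner_coeff \<beta> \<gamma> n 0) + meixner_coeff \<beta> \<gamma> (Suc n) 0"
proof -
  define P where "P = pochhammer (\<gamma> + 1) n * pochhammer (\<gamma> + \<beta>) n / fact n"
  have nz: "pochhammer (\<gamma> + 1) m \<noteq> 0" "pochhammer (\<gamma> + \<beta>) m \<noteq> 0" for m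
    using assms pochhammer_pos[of "\<gamma> + 1" m] pochhammer_pos[of "\<gamma> + \<beta>" m] by auto
  have e: "meixner_inhom \<beta> \<gamma> (Suc m) = (\<gamma> + \<beta> - 1) * \<gamma> *
      (pochhammer (\<gamma> + 1) m * pochhammer (\<gamma> + \<beta>) m) / fact (Suc m)" for m
    by (simp add: meixner_inhom_def pochhammer_rec mult_ac)
  have "meixner_coeff \<beta> \<gamma> n m * meixner_inhom \<beta> \<gamma> (Suc m) =
      P * ((\<gamma> + \<beta> - 1) * \<gamma>) * (pochhammer (- real n) m / fact (Suc m))" for m
    unfolding e using nz[of m] by (simp add: meixner_coeff_def P_def del: fact_Suc)
  then have "(\<Sum>m\<le>n. meixner_coeff \<beta> \<gamma> n m * meixner_inhom \<beta> \<gamma> (Suc m)) =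
      P * ((\<gamma> + \<beta> - 1) * \<gamma>) / (real n + 1)"
    by (simp only: sum_distrib_left[symmetric] sum_pochhammer_neg_div_fact_Suc) simp
  moreover have "meixner_coeff \<beta> \<gamma> n 0 = P"
    by (simp add: meixner_coeff_def P_def)
  moreover have "meixner_coeff \<beta> \<gamma> (Suc n) 0 =
      P * ((\<gamma> + 1 + real n) * (\<gamma> + \<beta> + real n)) / (real n + 1)"
    by (simp add: meixner_coeff_def P_def pochhammer_Suc divide_simps)
  \<comment> \<open>Again the factorization of f(m) - f(n) for f(y) = (\<gamma> + 1 + y) (\<gamma> +
    \<beta> + y), now with m = -1.\<close>
  moreover have "P * ((\<gamma> + \<beta> - 1) * \<gamma>) / (real n + 1) =
      (real n + 2 * \<gamma> + \<beta>) * (- P) + P * ((\<gamma> + 1 + real n) * (\<gamma> + \<beta> + real n)) / (real n + 1)"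
    by (simp add: divide_simps) (simp add: algebra_simps)
  ultimately show ?thesis by simp
qed

section \<open>Three-term recurrence and induction\<close>

text \<open>This is the defining recurrence divided by c, where 1 / c = 1 - t and (c + 1) / c = 2 -
  t. The last sum stands for the term of index n - 1, rewritten by
  \<open>meixner_coeff_Suc_left\<close>.\<close>

lemma meixner_sum_rec:
  fixes \<beta> \<gamma> t x :: real and n :: nat
  defines "A \<equiv> meixner_coeff \<beta> \<gamma>" and "S \<equiv> meixner_basis \<beta> t \<gamma> x"
  assumes "\<gamma> > -1" "\<gamma> + \<beta> > 0"
  shows "(\<Sum>m\<le>Suc n. A (Suc n) m * S m) =
    (t * x + (2 - t) * (real n + \<gamma>) + \<beta>) * (\<Sum>m\<le>n. A n m * S m)
    - (1 - t) * (\<Sum>m\<le>n. (real n - real m) * A n m * S m)"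
proof -
  let ?w = "\<lambda>m. real n + real m + 2 * \<gamma> + \<beta>"
  let ?e = "meixner_inhom \<beta> \<gamma>"
  have S0: "S 0 = 1" and SSuc: "S (Suc m) = t * (\<gamma> - x + real m) * S m + ?e (Suc m)" for m
    by (simp_all add: S_def meixner_basis_Suc)
  have "(\<Sum>m\<le>Suc n. A (Suc n) m * S m) = A (Suc n) 0 + (\<Sum>m\<le>n. A (Suc n) (Suc m) * S (Suc m))"
    by (subst sum.atMost_Suc_shift) (simp add: S0)
  also have "(\<Sum>m\<le>n. A (Suc n) (Suc m) * S (Suc m)) =
      (\<Sum>m\<le>n. ?w (Suc m) * A n (Suc m) * S (Suc m)) - (\<Sum>m\<le>n. A n m * S (Suc m))"
    unfolding A_def meixner_coeff_Suc_Suc[OF assms(3,4)] left_diff_distrib sum_subtractf ..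
  \<comment> \<open>The missing term m = 0 is added and subtracted; the top term m = n + 1 then
    drops out because \<open>A n (Suc n)\<close> is 0.\<close>
  also have "(\<Sum>m\<le>n. ?w (Suc m) * A n (Suc m) * S (Suc m)) =
      (\<Sum>m\<le>Suc n. ?w m * A n m * S m) - ?w 0 * A n 0"
    by (subst sum.atMost_Suc_shift) (simp add: S0)
  also have "(\<Sum>m\<le>Suc n. ?w m * A n m * S m) = (\<Sum>m\<le>n. ?w m * A n m * S m)"
    by (simp add: A_def meixner_coeff_eq_0)
  also have "(\<Sum>m\<le>n. A n m * S (Suc m)) =
      (\<Sum>m\<le>n. t * (\<gamma> - x + real m) * A n m * S m) + (\<Sum>m\<le>n. A n m * ?e (Suc m))"
    unfolding sum.distrib[symmetric] SSuc by (rule sum.cong) (simp_all add: algebra_simps)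
  \<comment> \<open>This cancels exactly the two terms from m = 0, namely \<open>A (Suc n) 0\<close>
    and \<open>?w 0 * A n 0\<close>.\<close>
  also have "(\<Sum>m\<le>n. A n m * ?e (Suc m)) = ?w 0 * (- A n 0) + A (Suc n) 0"
    using sum_meixner_coeff_inhom[OF assms(3,4), of n] by (simp add: A_def)
  finally have "(\<Sum>m\<le>Suc n. A (Suc n) m * S m) =
      (\<Sum>m\<le>n. ?w m * A n m * S m) - (\<Sum>m\<le>n. t * (\<gamma> - x + real m) * A n m * S m)"
    by simp
  \<comment> \<open>Termwise, w(m) - t (\<gamma> - x + m) = t x + (2 - t) (n + \<gamma>) + \<beta> -
    (1 - t) (n - m).\<close>
  also have "\<dots> = (t * x + (2 - t) * (real n + \<gamma>) + \<beta>) * (\<Sum>m\<le>n. A n m * S m)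
    - (1 - t) * (\<Sum>m\<le>n. (real n - real m) * A n m * S m)"
    unfolding sum_distrib_left sum_subtractf[symmetric]
    by (rule sum.cong) (simp_all add: algebra_simps)
  finally show ?thesis .
qed

lemma poly_assoc_meixner_eq_sum:
  assumes "c \<noteq> 0" "\<gamma> > -1" "\<gamma> + \<beta> > 0"
  shows "poly (assoc_meixner \<beta> c \<gamma> n) x =
    (\<Sum>m\<le>n. meixner_coeff \<beta> \<gamma> n m * meixner_basis \<beta> ((c - 1) / c) \<gamma> x m)"
proof -
  define t where "t = (c - 1) / c"
  let ?F = "\<lambda>n. \<Sum>m\<le>n. meixner_coeff \<beta> \<gamma> n m * meixner_basis \<beta> t \<gamma> x m"
  define prev where "prev = (\<lambda>n. case n of 0 \<Rightarrow> 0 | Suc m \<Rightarrow> assoc_meixner \<beta> c \<gamma> m)"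
  have rec: "poly (assoc_meixner \<beta> c \<gamma> (Suc n)) x =
      (t * x + (2 - t) * (real n + \<gamma>) + \<beta>) * poly (assoc_meixner \<beta> c \<gamma> n) x
      - (1 - t) * ((real n + \<gamma>) * (real n + \<gamma> + \<beta> - 1) * poly (prev n) x)" for n
  proof -
    let ?M = "poly (assoc_meixner \<beta> c \<gamma> n) x"
    let ?R = "(real n + \<gamma>) * (real n + \<gamma> + \<beta> - 1) * poly (prev n) x"
    let ?L = "(c + 1) * (real n + \<gamma>) + \<beta> * c + x * (c - 1)"
    have t: "1 - t = 1 / c" using assms(1) by (simp add: t_def divide_simps)
    have L: "?L / c = t * x + (2 - t) * (real n + \<gamma>) + \<beta>"
      using assms(1) by (simp add: t_def field_simps)
    have "poly (assoc_meixner \<beta> c \<gamma> (Suc n)) x = 1 / c * (?L * ?M - ?R)"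
      by (simp add: prev_def distrib_right mult.assoc)
    also have "\<dots> = ?L / c * ?M - 1 / c * ?R"
      by (simp add: diff_divide_distrib)
    finally show ?thesis by (simp only: L t)
  qed
  \<comment> \<open>For n = 0 both sides are 0: \<open>prev 0\<close> is 0, and the only summand has
    the factor 0 - 0.\<close>
  have prev_sum: "(real n + \<gamma>) * (real n + \<gamma> + \<beta> - 1) * poly (prev n) x =
      (\<Sum>m\<le>n. (real n - real m) * meixner_coeff \<beta> \<gamma> n m * meixner_basis \<beta> t \<gamma> x m)"
    if "\<And>k. k < n \<Longrightarrow> poly (assoc_meixner \<beta> c \<gamma> k) x = ?F k" for n
  proof (cases n)
    case 0
    then show ?thesis by (simp add: prev_def)
  next
    case (Suc k)
    have "(\<Sum>m\<le>n. (real n - real m) * meixner_coeff \<beta> \<gamma> n m * meixner_basis \<beta> t \<gamma> x m) =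
        (real n + \<gamma>) * (real k + \<gamma> + \<beta>) *
          (\<Sum>m\<le>Suc k. meixner_coeff \<beta> \<gamma> k m * meixner_basis \<beta> t \<gamma> x m)"
      unfolding Suc meixner_coeff_Suc_left sum_distrib_left mult.assoc ..
    also have "(\<Sum>m\<le>Suc k. meixner_coeff \<beta> \<gamma> k m * meixner_basis \<beta> t \<gamma> x m) = ?F k"
      by (simp add: meixner_coeff_eq_0)
    finally show ?thesis
      using that[of k] Suc by (simp add: prev_def)
  qed
  have "poly (assoc_meixner \<beta> c \<gamma> n) x = ?F n"
  \<comment> \<open>Strong induction, since the recurrence looks back two indices.\<close>
  proof (induction n rule: less_induct)
    case (less n)
    show ?case
    proof (cases n)
      case 0
      then show ?thesis by (simp add: meixner_coeff_def)
    next
      case (Suc k)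
      then show ?thesis
        using less.IH rec[of k] prev_sum[of k]
          meixner_sum_rec[OF assms(2,3), of k t x] by simp
    qed
  qed
  then show ?thesis by (simp add: t_def)
qed

section \<open>The hypergeometric double sum and its limits\<close>

lemma hyp4F3_double_sum_eq:
  fixes \<beta> \<gamma> t x :: real
  assumes "\<gamma> > -1" "\<gamma> + \<beta> > 0" and nz: "\<And>j. j \<le> n \<Longrightarrow> pochhammer (\<gamma> - x) j \<noteq> 0"
  shows "pochhammer (\<gamma> + 1) n * pochhammer (\<gamma> + \<beta>) n / fact n *
           (\<Sum>k=0..n. t ^ k *
              (pochhammer (- real n) k * pochhammer (\<gamma> - x) k
                / (pochhammer (\<gamma> + 1) k * pochhammer (\<gamma> + \<beta>) k)) *
              hyp4F3_one (n - k) (\<gamma> - x + real k) (\<gamma> + \<beta> - 1) \<gamma>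
                (\<gamma> - x) (\<gamma> + \<beta> + real k) (\<gamma> + 1 + real k)) =
    (\<Sum>m\<le>n. meixner_coeff \<beta> \<gamma> n m * meixner_basis \<beta> t \<gamma> x m)"
    (is "?P * (\<Sum>k=0..n. ?T k * hyp4F3_one _ _ _ _ _ _ _) = _")
proof -
  define g where "g k j = meixner_coeff \<beta> \<gamma> n (k + j) *
      (t ^ k * pochhammer (\<gamma> - x + real j) k * meixner_inhom \<beta> \<gamma> j)" for k j
  let ?s = "\<lambda>k j. pochhammer (- real (n - k)) j * pochhammer (\<gamma> - x + real k) j *
      pochhammer (\<gamma> + \<beta> - 1) j * pochhammer \<gamma> j /
      (pochhammer (\<gamma> - x) j * pochhammer (\<gamma> + \<beta> + real k) j * pochhammer (\<gamma> + 1 + real k) j * fact j)"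
  have "?P * (?T k * ?s k j) = g k j" if "k \<le> n" "j \<le> n - k" for k j
  proof -
    have n: "pochhammer (- real n) (k + j) = pochhammer (- real n) k * pochhammer (- real (n - k)) j"
      using that by (simp add: pochhammer_product' of_nat_diff)
    \<comment> \<open>Both sides equal (\<gamma> - x)_(k + j). Dividing by (\<gamma> - x)_j, nonzero
      by \<open>nz\<close>, gives the polynomial form used in \<open>meixner_basis\<close>.\<close>
    have "pochhammer (\<gamma> - x) k * pochhammer (\<gamma> - x + real k) j =
        pochhammer (\<gamma> - x) j * pochhammer (\<gamma> - x + real j) k"
      by (metis add.commute pochhammer_product')
    then have "pochhammer (\<gamma> - x + real j) k =
        pochhammer (\<gamma> - x) k * pochhammer (\<gamma> - x + real k) j / pochhammer (\<gamma> - x) j"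
      using nz[of j] that by (simp add: divide_simps mult.commute)
    then show ?thesis
      by (simp add: g_def meixner_coeff_def meixner_inhom_def n pochhammer_product' that mult_ac)
  qed
  then have "?P * (\<Sum>k=0..n. ?T k * hyp4F3_one (n - k) (\<gamma> - x + real k) (\<gamma> + \<beta> - 1) \<gamma>
                (\<gamma> - x) (\<gamma> + \<beta> + real k) (\<gamma> + 1 + real k)) = (\<Sum>k\<le>n. \<Sum>j\<le>n - k. g k j)"
    unfolding hyp4F3_one_def sum_distrib_left atLeast0AtMost by (intro sum.cong) auto
  also have "\<dots> = (\<Sum>(k, j)\<in>{(k, j). k + j \<le> n}. g k j)"
    by (subst sum.Sigma) (auto intro!: sum.cong)
  also have "\<dots> = (\<Sum>m\<le>n. \<Sum>k\<le>m. g k (m - k))"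
    by (rule sum.triangle_reindex_eq)
  also have "\<dots> = (\<Sum>m\<le>n. meixner_coeff \<beta> \<gamma> n m * meixner_basis \<beta> t \<gamma> x m)"
    unfolding meixner_basis_def sum_distrib_left by (intro sum.cong) (auto simp: g_def)
  finally show ?thesis .
qed

text \<open>Where a lower parameter makes a denominator vanish, \<open>rhs\<close> takes the default
  value of division by zero. The convention of continuity in x is therefore expressed by a limit,
  and the plain equation by values away from these points.\<close>

theorem mainTheorem4:
  fixes \<beta> c \<gamma> :: real and n :: nat
  assumes "c > 0" and "c \<noteq> 1" and "\<gamma> \<ge> 0" and "\<gamma> + \<beta> > 0"
  shows "let rhs = (\<lambda>x::real.
           pochhammer (\<gamma> + 1) n * pochhammer (\<gamma> + \<beta>) n / fact n *
           (\<Sum>k=0..n. ((c - 1) / c) ^ k *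
              (pochhammer (- real n) k * pochhammer (\<gamma> - x) k
                / (pochhammer (\<gamma> + 1) k * pochhammer (\<gamma> + \<beta>) k)) *
              hyp4F3_one (n - k) (\<gamma> - x + real k) (\<gamma> + \<beta> - 1) \<gamma>
                (\<gamma> - x) (\<gamma> + \<beta> + real k) (\<gamma> + 1 + real k)))
         in (\<forall>x. (\<forall>j\<le>n. pochhammer (\<gamma> - x) j \<noteq> 0) \<longrightarrow> poly (assoc_meixner \<beta> c \<gamma> n) x = rhs x) \<and>
            (\<forall>x. (rhs \<longlongrightarrow> poly (assoc_meixner \<beta> c \<gamma> n) x) (at x))"
proof -
  define rhs where "rhs = (\<lambda>x::real.
           pochhammer (\<gamma> + 1) n * pochhammer (\<gamma> + \<beta>) n / fact n *
           (\<Sum>k=0..n. ((c - 1) / c) ^ k *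
              (pochhammer (- real n) k * pochhammer (\<gamma> - x) k
                / (pochhammer (\<gamma> + 1) k * pochhammer (\<gamma> + \<beta>) k)) *
              hyp4F3_one (n - k) (\<gamma> - x + real k) (\<gamma> + \<beta> - 1) \<gamma>
                (\<gamma> - x) (\<gamma> + \<beta> + real k) (\<gamma> + 1 + real k)))"
  have eq: "poly (assoc_meixner \<beta> c \<gamma> n) x = rhs x" if "\<forall>j\<le>n. pochhammer (\<gamma> - x) j \<noteq> 0" for x
    using hyp4F3_double_sum_eq[of \<gamma> \<beta> n x "(c - 1) / c"] poly_assoc_meixner_eq_sum[of c \<gamma> \<beta> n x]
      assms that unfolding rhs_def by simp
  have "(rhs \<longlongrightarrow> poly (assoc_meixner \<beta> c \<gamma> n) x) (at x)" for x
  proof -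
    \<comment> \<open>The points \<gamma> + i with i < n are the only zeros of (\<gamma> - x)_j for
      j \<le> n. Removing x makes \<open>- Z\<close> an open neighbourhood of x on which, apart from
      x itself, \<open>eq\<close> applies.\<close>
    define Z where "Z = (\<lambda>i. \<gamma> + real i) ` {..<n} - {x}"
    have "open (- Z)"
      unfolding Z_def by (intro open_Compl finite_imp_closed) simp
    then have "\<forall>\<^sub>F y in at x. y \<in> - Z \<and> y \<noteq> x"
      by (intro eventually_conj eventually_at_in_open' eventually_neq_at_within) (simp_all add: Z_def)
    then have "\<forall>\<^sub>F y in at x. poly (assoc_meixner \<beta> c \<gamma> n) y = rhs y"
    proof eventually_elim
      case (elim y)
      then have "\<gamma> - y \<noteq> - real i" if "i < n" for i
        using that by (force simp: Z_def)
      then show ?case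
        by (intro eq) (auto simp: pochhammer_eq_0_iff)
    qed
    moreover have "(poly (assoc_meixner \<beta> c \<gamma> n) \<longlongrightarrow> poly (assoc_meixner \<beta> c \<gamma> n) x) (at x)"
      using poly_isCont unfolding isCont_def by blast
    ultimately show ?thesis
      by (rule Lim_transform_eventually[rotated])
  qed
  with eq show ?thesis
    unfolding Let_def rhs_def[symmetric] by blast
qed

end
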